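(* For every $n\in\mathbb{N}_{>0}$ and every distribution $D$ as in the model of the context, the algorithm $\textsc{Simple}$ with threshold $\delta_{1-\frac{2}{n}}$ satisfies \[\frac{\mathbb{E}[\textsc{Simple}_n]}{\mathbb{E}[\textsc{Opt}_n]}\ \ge\ \frac{1+e^{-2}}{3-e^{-2}}\ (>0.396).\]
   Context: Model (prophet-inequality over time). Fix $n\in\mathbb{N}_{>0}$ and a continuous distribution $D$ with density $f$ and cumulative distribution function $F$, supported on non-negative numbers ($F(0)=0$), with finite expectation. Random variables $x_1,\dots,x_n$ are i.i.d. with distribution $D$ and revealed one by one. In step $i$, if step $i$ is not covered by an earlier selection, the decider chooses $t_i\in\{1,\dots,n-i+1\}$ and gains $x_i$ for $t_i$ steps (steps $i,\dots,i+t_i-1$ become covered); if step $i$ is covered (i.e. $i\le j+t_j-1$ for some $j<i$), then $t_i=0$. The total value is $\sum_i x_it_i$. An online algorithm chooses $t_i$ knowing only $n$, $D$, $x_1,\dots,x_i$, $t_1,\dots,t_{i-1}$; $\mathbb{E}[\textsc{Alg}_n]$ is its expected total value. $\textsc{Opt}_n$ is the maximum of $\sum_i x_it_i$ over all feasible choices of $t_1,\dots,t_n$ made with full knowledge of $x_1,\dots,x_n$, and $\mathbb{E}[\textsc{Opt}_n]$ its expectation. For $p\in[0,1]$, $\delta_p$ denotes the $p$-quantile of $D$, i.e. a value with $\Pr_{x\sim D}[x\le\delta_p]=p$; for $p<0$, $\delta_p=0$. The algorithm $\textsc{Simple}$ with threshold $\delta_q$: for $i=1,\dots,n$, if $x_i>\delta_q$,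 select $x_i$ for all $n-i+1$ remaining steps and stop; otherwise select $x_i$ only in step $i$ ($t_i=1$). *)

theory Defs
  imports "HOL-Probability.Probability"
begin

definition value_distribution :: "real measure \<Rightarrow> (real \<Rightarrow> real) \<Rightarrow> bool" where
  "value_distribution D f \<longleftrightarrow>
     prob_space D \<and>
     f \<in> borel_measurable lborel \<and> (\<forall>x. 0 \<le> f x) \<and>
     D = density lborel (\<lambda>x. ennreal (f x)) \<and>
     cdf D 0 = 0 \<and>
     integrable D (\<lambda>x. x)"

text \<open>A quantile need not be unique; this is a relation between a level and its possible values.
  Negative levels have the value 0 by convention.\<close>

definition is_quantile :: "real measure \<Rightarrow> real \<Rightarrow> real \<Rightarrow> bool" where
  "is_quantile D p \<delta> \<longleftrightarrow> (if p < 0 then \<delta> = 0 else cdf D \<delta> = p)"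

text \<open>Steps are numbered from 1. A choice \<^term>\<open>t :: nat \<Rightarrow> nat\<close> gives the number of steps for
  which each value is selected; only its restriction to \<^term>\<open>{1..n::nat}\<close> matters.
  As \<open>j \<ge> 1\<close> below, the subtraction on naturals does not truncate.\<close>

definition covered :: "(nat \<Rightarrow> nat) \<Rightarrow> nat \<Rightarrow> bool" where
  "covered t i \<longleftrightarrow> (\<exists>j\<in>{1..<i}. i \<le> j + t j - 1)"

definition feasible :: "nat \<Rightarrow> (nat \<Rightarrow> nat) \<Rightarrow> bool" where
  "feasible n t \<longleftrightarrow>
     (\<forall>i\<in>{1..n}. if covered t i then t i = 0 else t i \<in> {1..n - i + 1})"

definition total_value :: "nat \<Rightarrow> (nat \<Rightarrow> real) \<Rightarrow> (nat \<Rightarrow> nat) \<Rightarrow> real" where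
  "total_value n x t = (\<Sum>i=1..n. x i * real (t i))"

definition opt_value :: "nat \<Rightarrow> (nat \<Rightarrow> real) \<Rightarrow> real" where
  "opt_value n x = Max {total_value n x t | t. feasible n t}"

definition simple_choice :: "nat \<Rightarrow> real \<Rightarrow> (nat \<Rightarrow> real) \<Rightarrow> nat \<Rightarrow> nat" where
  "simple_choice n \<delta> x i =
     (if \<exists>j\<in>{1..<i}. x j > \<delta> then 0
      else if x i > \<delta> then n - i + 1
      else 1)"

definition simple_value :: "nat \<Rightarrow> real \<Rightarrow> (nat \<Rightarrow> real) \<Rightarrow> real" where
  "simple_value n \<delta> x = total_value n x (simple_choice n \<delta> x)"

lemma simple_choice_feasible: "feasible n (simple_choice n \<delta> x)"
proof -
  have "covered (simple_choice n \<delta> x) i \<longleftrightarrow> (\<exists>j\<in>{1..<i}. x j > \<delta>)" if i: "i \<in> {1..n}" for i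
  proof
    assume "covered (simple_choice n \<delta> x) i"
    then obtain j where j: "j \<in> {1..<i}" "i \<le> j + simple_choice n \<delta> x j - 1"
      unfolding covered_def by blast
    show "\<exists>j\<in>{1..<i}. x j > \<delta>"
    proof (rule ccontr)
      assume none: "\<not> (\<exists>j\<in>{1..<i}. x j > \<delta>)"
      with j(1) have "simple_choice n \<delta> x j = 1"
        unfolding simple_choice_def by auto
      with j show False by auto
    qed
  next
    assume ex: "\<exists>j\<in>{1..<i}. x j > \<delta>"
    define k where "k = (LEAST j. j \<in> {1..<i} \<and> x j > \<delta>)"
    from ex have "\<exists>j. j \<in> {1..<i} \<and> x j > \<delta>" by blast
    then have "k \<in> {1..<i} \<and> x k > \<delta>" unfolding k_def by (rule LeastI_ex)
    then have k: "k \<in> {1..<i}" "x k > \<delta>" by blast+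
    have "\<not> x j > \<delta>" if "j \<in> {1..<k}" for j
      using that k(1) not_less_Least[of j "\<lambda>j. j \<in> {1..<i} \<and> x j > \<delta>"]
      unfolding k_def[symmetric] by auto
    with k have "simple_choice n \<delta> x k = n - k + 1"
      unfolding simple_choice_def by auto
    with k i show "covered (simple_choice n \<delta> x) i"
      unfolding covered_def by (intro bexI[of _ k]) auto
  qed
  then show ?thesis
    unfolding feasible_def by (auto simp: simple_choice_def)
qed

lemma finite_total_values: "finite {total_value n x t | t. feasible n t}"
proof (rule finite_subset)
  show "{total_value n x t | t. feasible n t}
        \<subseteq> total_value n x ` ({1..n} \<rightarrow>\<^sub>E {0..n})"
  proof clarify
    fix t assume t: "feasible n t"
    have "total_value n x t = total_value n x (restrict t {1..n})"
      by (simp add: total_value_def)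
    moreover have "t i \<le> n" if "i \<in> {1..n}" for i
    proof -
      have "if covered t i then t i = 0 else t i \<in> {1..n - i + 1}"
        using t that unfolding feasible_def by blast
      with that show ?thesis by (auto split: if_splits)
    qed
    then have "restrict t {1..n} \<in> {1..n} \<rightarrow>\<^sub>E {0..n}" by auto
    ultimately show "total_value n x t \<in> total_value n x ` ({1..n} \<rightarrow>\<^sub>E {0..n})"
      by blast
  qed
qed (intro finite_imageI finite_PiE; simp)

end

theory Submission imports Defs begin

text \<open>Put \<open>\<theta> = max 0 \<delta>\<close>. The selected blocks are disjoint, so \<open>\<Sum> t\<^sub>i \<le> n\<close> and
  \<open>Opt \<le> n \<theta> + \<Sum> (n - i + 1) (x\<^sub>i - \<theta>)\<^sup>+\<close>. With \<open>q = F(\<delta>)\<close>, \<open>p = 1 - q\<close> and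
  \<open>a = E (x - \<theta>)\<^sup>+\<close>, a value above the threshold contributes \<open>p \<theta> + a\<close> on average, and step \<open>i\<close>
  is reached uncovered with probability \<open>q\<^sup>i\<^sup>-\<^sup>1\<close>, so Simple gains at least \<open>S (p \<theta> + a)\<close> where
  \<open>S = \<Sum> q\<^sup>i\<^sup>-\<^sup>1 (n - i + 1)\<close>. For \<open>n \<ge> 2\<close>, where \<open>q = 1 - 2/n\<close>, the closed form of \<open>S\<close> gives
  \<open>S \<ge> n (n + 1) / 4\<close> and \<open>S p \<ge> n / 2\<close>: the coefficients of \<open>a\<close> and of \<open>\<theta>\<close> are each at least
  half of those in the bound for Opt. This yields the ratio 1/2, which exceeds the claimed one.\<close>

subsection \<open>Offline optimum\<close>

lemma feasible_bound:
  assumes "feasible n t" "i \<in> {1..n}"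
  shows "t i \<le> n - i + 1"
proof -
  have "if covered t i then t i = 0 else t i \<in> {1..n - i + 1}"
    using assms unfolding feasible_def by blast
  then show ?thesis by (auto split: if_splits)
qed

text \<open>Choice \<open>t i\<close> occupies the interval \<open>A i\<close>. A covered later
  index has an empty interval, and an uncovered one lies past the end of every earlier interval, so
  the intervals are pairwise disjoint. The cap \<open>n - i + 1\<close> keeps each inside
  \<open>{1..n}\<close>, and counting points gives the bound.\<close>

lemma feasible_sum_le:
  assumes t: "feasible n t"
  shows "(\<Sum>i=1..n. t i) \<le> n"
proof -
  define A where "A i = {i..<i + t i}" for i
  have disj: "A i \<inter> A j = {}" if "i \<in> {1..n}" "j \<in> {1..n}" "i < j" for i j
  proof (cases "covered t j")
    case True
    then have "t j = 0" using t that unfolding feasible_def by auto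
    then show ?thesis by (simp add: A_def)
  next
    case False
    then have "\<not> j \<le> i + t i - 1" using that unfolding covered_def by auto
    then show ?thesis by (auto simp: A_def)
  qed
  have "(\<Sum>i=1..n. t i) = (\<Sum>i=1..n. card (A i))" by (simp add: A_def)
  also have "\<dots> = card (\<Union>i\<in>{1..n}. A i)"
  proof (rule card_UN_disjoint[symmetric])
    show "\<forall>i\<in>{1..n}. \<forall>j\<in>{1..n}. i \<noteq> j \<longrightarrow> A i \<inter> A j = {}"
      using disj by (metis inf_commute linorder_neqE_nat)
  qed (auto simp: A_def)
  also have "\<dots> \<le> card {1..n}"
  proof (rule card_mono)
    show "(\<Union>i\<in>{1..n}. A i) \<subseteq> {1..n}"
    proof
      fix k assume "k \<in> (\<Union>i\<in>{1..n}. A i)"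
      then obtain i where "i \<in> {1..n}" "i \<le> k" "k < i + t i" by (auto simp: A_def)
      with feasible_bound[OF t, of i] show "k \<in> {1..n}" by auto
    qed
  qed simp
  finally show ?thesis by simp
qed

text \<open>Each value is at most \<open>\<theta>\<close> plus its excess over
  \<open>\<theta>\<close>. The constant part is charged to the total length of all blocks, the
  excess to the largest length that a block starting at \<open>i\<close> can have.\<close>

lemma total_value_le:
  assumes t: "feasible n t" and "0 \<le> \<theta>"
  shows "total_value n x t \<le> real n * \<theta> + (\<Sum>i=1..n. real (n - i + 1) * max 0 (x i - \<theta>))"
proof -
  have "total_value n x t \<le> (\<Sum>i=1..n. real (t i) * \<theta> + real (n - i + 1) * max 0 (x i - \<theta>))"
    unfolding total_value_def
  proof (rule sum_mono)
    fix i assume i: "i \<in> {1..n}"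
    have "x i * real (t i) \<le> real (t i) * \<theta> + real (t i) * max 0 (x i - \<theta>)"
    proof -
      have "real (t i) * x i \<le> real (t i) * (\<theta> + max 0 (x i - \<theta>))"
        by (intro mult_left_mono) auto
      then show ?thesis by (simp add: algebra_simps)
    qed
    also have "real (t i) * max 0 (x i - \<theta>) \<le> real (n - i + 1) * max 0 (x i - \<theta>)"
      using feasible_bound[OF t i] by (intro mult_right_mono of_nat_mono) auto
    finally show "x i * real (t i) \<le> real (t i) * \<theta> + real (n - i + 1) * max 0 (x i - \<theta>)"
      by simp
  qed
  also have "\<dots> = real (\<Sum>i=1..n. t i) * \<theta> + (\<Sum>i=1..n. real (n - i + 1) * max 0 (x i - \<theta>))"
    by (simp add: sum.distrib sum_distrib_right)
  also have "real (\<Sum>i=1..n. t i) * \<theta> \<le> real n * \<theta>"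
    using feasible_sum_le[OF t] \<open>0 \<le> \<theta>\<close> by (intro mult_right_mono of_nat_mono)
  finally show ?thesis by simp
qed

lemma total_value_le_opt_value:
  assumes "feasible n t"
  shows "total_value n x t \<le> opt_value n x"
  unfolding opt_value_def using assms by (intro Max_ge finite_total_values) blast

lemma opt_value_le:
  assumes "0 \<le> \<theta>"
  shows "opt_value n x \<le> real n * \<theta> + (\<Sum>i=1..n. real (n - i + 1) * max 0 (x i - \<theta>))"
  unfolding opt_value_def
  using total_value_le[OF _ assms] simple_choice_feasible finite_total_values
  by (subst Max_le_iff) blast+

text \<open>This serves measurability: the maximum now ranges over a finite set of choices that does
  not depend on \<open>x\<close>. Restricting a choice to \<open>{1..n}\<close> changes neither its
  value nor which steps in \<open>{1..n}\<close> are covered.\<close>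

lemma opt_value_eq_Max_image:
  "opt_value n x = Max (total_value n x ` {t \<in> {1..n} \<rightarrow>\<^sub>E {0..n}. feasible n t})"
proof -
  have "{total_value n x t | t. feasible n t}
      \<subseteq> total_value n x ` {t \<in> {1..n} \<rightarrow>\<^sub>E {0..n}. feasible n t}"
  proof clarify
    fix t assume t: "feasible n t"
    have "total_value n x t = total_value n x (restrict t {1..n})"
      by (simp add: total_value_def)
    moreover have "t i \<le> n" if "i \<in> {1..n}" for i
      using feasible_bound[OF t that] that by auto
    then have "restrict t {1..n} \<in> {1..n} \<rightarrow>\<^sub>E {0..n}" by auto
    moreover have "covered (restrict t {1..n}) i = covered t i" if "i \<in> {1..n}" for i
      unfolding covered_def using that by (intro bex_cong) auto
    then have "feasible n (restrict t {1..n})"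
      using t unfolding feasible_def by (metis restrict_apply')
    ultimately show "total_value n x t
        \<in> total_value n x ` {t \<in> {1..n} \<rightarrow>\<^sub>E {0..n}. feasible n t}"
      by blast
  qed
  then have "{total_value n x t | t. feasible n t}
      = total_value n x ` {t \<in> {1..n} \<rightarrow>\<^sub>E {0..n}. feasible n t}"
    by blast
  then show ?thesis by (simp add: opt_value_def)
qed

lemma borel_measurable_opt_value:
  assumes "\<And>i. i \<in> {1..n} \<Longrightarrow> X i \<in> borel_measurable M"
  shows "(\<lambda>\<omega>. opt_value n (\<lambda>i. X i \<omega>)) \<in> borel_measurable M"
  unfolding opt_value_eq_Max_image total_value_def
proof (rule borel_measurable_Max)
  show "finite {t \<in> {1..n} \<rightarrow>\<^sub>E {0..n}. feasible n t}"
    by (rule finite_subset[of _ "{1..n} \<rightarrow>\<^sub>E {0..n}"]) (auto intro: finite_PiE)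
qed (use assms in \<open>auto intro!: borel_measurable_sum borel_measurable_times\<close>)

subsection \<open>The weights of the threshold algorithm\<close>

text \<open>The product of indicators is 1 exactly when step \<open>i\<close> is reached uncovered.
  In this form every summand is a product of functions of distinct coordinates, ready for
  independence.\<close>

lemma simple_value_eq:
  "simple_value n \<delta> x =
     (\<Sum>i=1..n. real (n - i + 1) *
          ((\<Prod>j\<in>{1..<i}. indicator {..\<delta>} (x j)) * (indicator {\<delta><..} (x i) * x i)) +
        (\<Prod>j\<in>{1..<i}. indicator {..\<delta>} (x j)) * (indicator {..\<delta>} (x i) * x i))"
  unfolding simple_value_def total_value_def
proof (rule sum.cong[OF refl])
  fix i
  show "x i * real (simple_choice n \<delta> x i) = real (n - i + 1) *
          ((\<Prod>j\<in>{1..<i}. indicator {..\<delta>} (x j)) * (indicator {\<delta><..} (x i) * x i)) +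
        (\<Prod>j\<in>{1..<i}. indicator {..\<delta>} (x j)) * (indicator {..\<delta>} (x i) * x i)"
  proof (cases "\<exists>j\<in>{1..<i}. x j > \<delta>")
    case True
    then obtain j where "j \<in> {1..<i}" "x j > \<delta>" by blast
    then have "(\<Prod>j\<in>{1..<i}. indicator {..\<delta>} (x j) :: real) = 0"
      by (intro prod_zero bexI[of _ j]) simp_all
    moreover have "simple_choice n \<delta> x i = 0"
      unfolding simple_choice_def using True by (simp only: if_True)
    ultimately show ?thesis by (simp only: mult_zero_left mult_zero_right of_nat_0 add_0)
  next
    case False
    then have "x j \<le> \<delta>" if "j \<in> {1..<i}" for j using that by (meson not_less)
    then have "(\<Prod>j\<in>{1..<i}. indicator {..\<delta>} (x j) :: real) = 1"
      by (intro prod.neutral ballI) simp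
    moreover have "simple_choice n \<delta> x i = (if x i > \<delta> then n - i + 1 else 1)"
      unfolding simple_choice_def using False by (simp only: if_False)
    ultimately show ?thesis by (cases "x i > \<delta>") simp_all
  qed
qed

text \<open>Splitting off the first summand shows that the sum for \<open>Suc n\<close> is
  \<open>n + 1\<close> plus \<open>q\<close> times the sum for \<open>n\<close>. The factor
  \<open>(1 - q)\<^sup>2\<close> clears the denominators, so the induction is polynomial
  arithmetic.\<close>

lemma sum_power_times_remaining:
  fixes q :: real
  shows "(1 - q)\<^sup>2 * (\<Sum>i<n. q ^ i * real (n - i)) = real n * (1 - q) - q + q ^ (n + 1)"
proof (induction n)
  case (Suc n)
  have "(\<Sum>i<Suc n. q ^ i * real (Suc n - i)) = real n + 1 + q * (\<Sum>i<n. q ^ i * real (n - i))"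
    by (subst sum.lessThan_Suc_shift) (simp add: sum_distrib_left mult.assoc)
  then have "(1 - q)\<^sup>2 * (\<Sum>i<Suc n. q ^ i * real (Suc n - i))
      = (1 - q)\<^sup>2 * (real n + 1) + q * ((1 - q)\<^sup>2 * (\<Sum>i<n. q ^ i * real (n - i)))"
    by (simp add: algebra_simps)
  then show ?case
    unfolding Suc.IH by (simp add: power2_eq_square algebra_simps)
qed simp

text \<open>For this \<open>q\<close> one has \<open>n * (1 - q) - q = 1 + 2 / n\<close> and
  \<open>(1 - q)\<^sup>2 = 4 / n\<^sup>2\<close>. The remaining term \<open>q ^ (n + 1)\<close> of
  the closed form is nonnegative because \<open>n \<ge> 2\<close>, and is dropped.\<close>

lemma threshold_weight_ge:
  fixes n :: nat
  assumes "n \<ge> 2"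
  defines "q \<equiv> 1 - 2 / real n"
  shows "(\<Sum>i<n. q ^ i * real (n - i)) \<ge> real n * (real n + 2) / 4"
proof -
  define S where "S = (\<Sum>i<n. q ^ i * real (n - i))"
  have n: "real n > 0" and "q \<ge> 0" using assms by (auto simp: q_def field_simps)
  have "(1 - q)\<^sup>2 * S = real n * (1 - q) - q + q ^ (n + 1)"
    unfolding S_def by (rule sum_power_times_remaining)
  also have "\<dots> \<ge> 1 + 2 / real n"
    using n \<open>q \<ge> 0\<close> by (simp add: q_def)
  finally have "4 / (real n)\<^sup>2 * S \<ge> 1 + 2 / real n"
    by (simp add: q_def power_divide)
  then have "(real n)\<^sup>2 / 4 * (1 + 2 / real n) \<le> (real n)\<^sup>2 / 4 * (4 / (real n)\<^sup>2 * S)"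
    by (intro mult_left_mono) auto
  also have "\<dots> = S" using n by simp
  also have "(real n)\<^sup>2 / 4 * (1 + 2 / real n) = real n * (real n + 2) / 4"
    using n by (simp add: field_simps power2_eq_square)
  finally show ?thesis by (simp add: S_def)
qed

subsection \<open>Expectations\<close>

lemma (in prob_space) iid_product_expectation:
  fixes X :: "nat \<Rightarrow> 'a \<Rightarrow> real" and g h :: "real \<Rightarrow> real"
  assumes indep: "indep_vars (\<lambda>_. borel) X {1..n}"
    and D: "\<And>i. i \<in> {1..n} \<Longrightarrow> distr M borel (X i) = D"
    and i: "i \<in> {1..n}"
    and g: "integrable D g" and h: "integrable D h"
  shows "integrable M (\<lambda>\<omega>. (\<Prod>j\<in>{1..<i}. h (X j \<omega>)) * g (X i \<omega>))" (is ?int)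
    and "expectation (\<lambda>\<omega>. (\<Prod>j\<in>{1..<i}. h (X j \<omega>)) * g (X i \<omega>))
          = integral\<^sup>L D h ^ (i - 1) * integral\<^sup>L D g" (is ?eq)
proof -
  have setsD: "sets D = sets borel" using D[OF i] by (metis sets_distr)
  have [measurable]: "g \<in> borel_measurable borel" "h \<in> borel_measurable borel"
    using g h measurable_cong_sets[OF setsD refl] borel_measurable_integrable by blast+
  have X[measurable]: "X j \<in> borel_measurable M" if "j \<in> {1..n}" for j
    using indep that unfolding indep_vars_def by blast
  \<comment> \<open>A single family covers both kinds of factor, so that the product rules for
    independent variables apply to \<open>{1..i}\<close> at once.\<close>
  define G where "G j = (if j = i then g else h)" for j
  have Gm: "G j \<in> borel_measurable borel" for j by (simp add: G_def)
  have GD: "integrable D (G j)" for j using g h by (simp add: G_def)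
  have Gint: "integrable M (\<lambda>\<omega>. G j (X j \<omega>))"
    and Gexp: "expectation (\<lambda>\<omega>. G j (X j \<omega>)) = integral\<^sup>L D (G j)" if "j \<in> {1..i}" for j
  proof -
    from that i have j: "j \<in> {1..n}" by auto
    show "integrable M (\<lambda>\<omega>. G j (X j \<omega>))"
      using GD[of j] unfolding D[OF j, symmetric] integrable_distr_eq[OF X[OF j] Gm] .
    show "expectation (\<lambda>\<omega>. G j (X j \<omega>)) = integral\<^sup>L D (G j)"
      unfolding D[OF j, symmetric] integral_distr[OF X[OF j] Gm] ..
  qed
  have ind: "indep_vars (\<lambda>_. borel) (\<lambda>j \<omega>. G j (X j \<omega>)) {1..i}"
    by (rule indep_vars_compose2[OF indep_vars_subset[OF indep]]) (use i Gm in auto)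
  have split: "{1..i} = insert i {1..<i}" using i by auto
  have eq: "(\<Prod>j\<in>{1..i}. G j (X j \<omega>)) = (\<Prod>j\<in>{1..<i}. h (X j \<omega>)) * g (X i \<omega>)" for \<omega>
  proof -
    have "(\<Prod>j\<in>{1..<i}. G j (X j \<omega>)) = (\<Prod>j\<in>{1..<i}. h (X j \<omega>))"
      by (rule prod.cong) (auto simp: G_def)
    then show ?thesis unfolding split by (simp add: G_def mult.commute)
  qed
  have "integrable M (\<lambda>\<omega>. \<Prod>j\<in>{1..i}. G j (X j \<omega>))"
    by (rule indep_vars_integrable[OF _ ind]) (auto intro: Gint)
  then show ?int by (simp only: eq)
  have "expectation (\<lambda>\<omega>. \<Prod>j\<in>{1..i}. G j (X j \<omega>))
      = (\<Prod>j\<in>{1..i}. expectation (\<lambda>\<omega>. G j (X j \<omega>)))"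
    by (rule indep_vars_lebesgue_integral[OF _ ind]) (auto intro: Gint)
  also have "\<dots> = (\<Prod>j\<in>{1..i}. integral\<^sup>L D (G j))"
    by (rule prod.cong) (auto intro: Gexp)
  also have "\<dots> = (\<Prod>j\<in>{1..<i}. integral\<^sup>L D (G j)) * integral\<^sup>L D g"
    unfolding split by (simp add: G_def mult.commute)
  also have "(\<Prod>j\<in>{1..<i}. integral\<^sup>L D (G j)) = (\<Prod>j\<in>{1..<i}. integral\<^sup>L D h)"
    by (rule prod.cong) (auto simp: G_def)
  finally show ?eq by (simp only: eq) simp
qed

lemma (in prob_space) simple_value_expectation:
  fixes X :: "nat \<Rightarrow> 'a \<Rightarrow> real"
  assumes indep: "indep_vars (\<lambda>_. borel) X {1..n}"
    and D: "\<And>i. i \<in> {1..n} \<Longrightarrow> distr M borel (X i) = D"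
    and "prob_space D" "sets D = sets borel" and int: "integrable D (\<lambda>x. x)"
  shows "integrable M (\<lambda>\<omega>. simple_value n \<delta> (\<lambda>i. X i \<omega>))" (is ?int)
    and "expectation (\<lambda>\<omega>. simple_value n \<delta> (\<lambda>i. X i \<omega>)) =
          (\<Sum>i<n. cdf D \<delta> ^ i * real (n - i)) * (LINT x|D. indicator {\<delta><..} x * x) +
          (\<Sum>i<n. cdf D \<delta> ^ i) * (LINT x|D. indicator {..\<delta>} x * x)" (is ?eq)
proof -
  interpret D: prob_space D by fact
  note [measurable_cong] = \<open>sets D = sets borel\<close>
  have ind: "integrable D (indicator {..\<delta>} :: real \<Rightarrow> real)"
    by (rule D.integrable_const_bound[where B=1]) (auto simp: indicator_def)
  have hi: "integrable D (\<lambda>x. indicator {\<delta><..} x * x)"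
    and lo: "integrable D (\<lambda>x. indicator {..\<delta>} x * x)"
    using integrable_real_mult_indicator[OF _ int] by (simp_all add: mult.commute[of "indicator _ _"])
  have q: "integral\<^sup>L D (indicator {..\<delta>}) = cdf D \<delta>"
    by (simp add: cdf_def)
  \<comment> \<open>\<open>A\<close> treats values above the threshold, \<open>B\<close> those at or
    below it. In both, the \<open>i - 1\<close> earlier factors each contribute the probability
    \<open>cdf D \<delta>\<close> of staying at or below the threshold.\<close>
  have A: "integrable M (\<lambda>\<omega>. ((\<Prod>j\<in>{1..<i}. indicator {..\<delta>} (X j \<omega>)) * (indicator {\<delta><..} (X i \<omega>) * X i \<omega>) :: real))"
    "expectation (\<lambda>\<omega>. ((\<Prod>j\<in>{1..<i}. indicator {..\<delta>} (X j \<omega>)) * (indicator {\<delta><..} (X i \<omega>) * X i \<omega>) :: real))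
      = cdf D \<delta> ^ (i - 1) * (LINT x|D. indicator {\<delta><..} x * x)" if "i \<in> {1..n}" for i
    using iid_product_expectation[OF indep D that hi ind] by (simp_all only: q)
  have B: "integrable M (\<lambda>\<omega>. ((\<Prod>j\<in>{1..<i}. indicator {..\<delta>} (X j \<omega>)) * (indicator {..\<delta>} (X i \<omega>) * X i \<omega>) :: real))"
    "expectation (\<lambda>\<omega>. ((\<Prod>j\<in>{1..<i}. indicator {..\<delta>} (X j \<omega>)) * (indicator {..\<delta>} (X i \<omega>) * X i \<omega>) :: real))
      = cdf D \<delta> ^ (i - 1) * (LINT x|D. indicator {..\<delta>} x * x)" if "i \<in> {1..n}" for i
    using iid_product_expectation[OF indep D that lo ind] by (simp_all only: q)
  show ?int
    unfolding simple_value_eq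
    by (intro Bochner_Integration.integrable_sum Bochner_Integration.integrable_add
          integrable_mult_right A(1) B(1))
  have "expectation (\<lambda>\<omega>. simple_value n \<delta> (\<lambda>i. X i \<omega>)) =
      (\<Sum>i=1..n. real (n - i + 1) * (cdf D \<delta> ^ (i - 1) * (LINT x|D. indicator {\<delta><..} x * x))
        + cdf D \<delta> ^ (i - 1) * (LINT x|D. indicator {..\<delta>} x * x))"
    unfolding simple_value_eq
  proof (subst Bochner_Integration.integral_sum)
    fix i assume i: "i \<in> {1..n}"
    show "integrable M (\<lambda>\<omega>. real (n - i + 1) *
          ((\<Prod>j\<in>{1..<i}. indicator {..\<delta>} (X j \<omega>)) * (indicator {\<delta><..} (X i \<omega>) * X i \<omega>)) +
        (\<Prod>j\<in>{1..<i}. indicator {..\<delta>} (X j \<omega>)) * (indicator {..\<delta>} (X i \<omega>) * X i \<omega>))"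
      by (intro Bochner_Integration.integrable_add integrable_mult_right A(1) B(1) i)
  next
    show "(\<Sum>i=1..n. expectation (\<lambda>\<omega>. real (n - i + 1) *
          ((\<Prod>j\<in>{1..<i}. indicator {..\<delta>} (X j \<omega>)) * (indicator {\<delta><..} (X i \<omega>) * X i \<omega>)) +
        (\<Prod>j\<in>{1..<i}. indicator {..\<delta>} (X j \<omega>)) * (indicator {..\<delta>} (X i \<omega>) * X i \<omega>))) =
      (\<Sum>i=1..n. real (n - i + 1) * (cdf D \<delta> ^ (i - 1) * (LINT x|D. indicator {\<delta><..} x * x))
        + cdf D \<delta> ^ (i - 1) * (LINT x|D. indicator {..\<delta>} x * x))"
    proof (rule sum.cong[OF refl])
      fix i assume i: "i \<in> {1..n}"
      show "expectation (\<lambda>\<omega>. real (n - i + 1) *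
          ((\<Prod>j\<in>{1..<i}. indicator {..\<delta>} (X j \<omega>)) * (indicator {\<delta><..} (X i \<omega>) * X i \<omega>)) +
        (\<Prod>j\<in>{1..<i}. indicator {..\<delta>} (X j \<omega>)) * (indicator {..\<delta>} (X i \<omega>) * X i \<omega>)) =
        real (n - i + 1) * (cdf D \<delta> ^ (i - 1) * (LINT x|D. indicator {\<delta><..} x * x))
        + cdf D \<delta> ^ (i - 1) * (LINT x|D. indicator {..\<delta>} x * x)"
        by (subst Bochner_Integration.integral_add[OF integrable_mult_right[OF A(1)[OF i]] B(1)[OF i]])
           (simp only: integral_mult_right_zero A(2)[OF i] B(2)[OF i])
    qed
  qed
  \<comment> \<open>Indices now start at 0: the block length \<open>n - i + 1\<close> becomes
    \<open>n - i\<close>, and the exponent \<open>i - 1\<close> becomes \<open>i\<close>.\<close>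
  also have "\<dots> = (\<Sum>i<n. real (n - i) * (cdf D \<delta> ^ i * (LINT x|D. indicator {\<delta><..} x * x))
        + cdf D \<delta> ^ i * (LINT x|D. indicator {..\<delta>} x * x))"
    unfolding One_nat_def sum.atLeast1_atMost_eq by (intro sum.cong) (auto simp: Suc_diff_Suc)
  also have "\<dots> = (\<Sum>i<n. cdf D \<delta> ^ i * real (n - i)) * (LINT x|D. indicator {\<delta><..} x * x) +
          (\<Sum>i<n. cdf D \<delta> ^ i) * (LINT x|D. indicator {..\<delta>} x * x)"
    by (simp add: sum.distrib sum_distrib_right mult.assoc mult.left_commute)
  finally show ?eq .
qed

lemma (in prob_space) opt_value_expectation:
  fixes X :: "nat \<Rightarrow> 'a \<Rightarrow> real"
  assumes X: "\<And>i. i \<in> {1..n} \<Longrightarrow> X i \<in> borel_measurable M"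
    and D: "\<And>i. i \<in> {1..n} \<Longrightarrow> distr M borel (X i) = D"
    and "prob_space D" and int: "integrable D (\<lambda>x. x)" and \<theta>: "0 \<le> \<theta>"
  shows "integrable M (\<lambda>\<omega>. opt_value n (\<lambda>i. X i \<omega>))" (is ?int)
    and "expectation (\<lambda>\<omega>. opt_value n (\<lambda>i. X i \<omega>))
          \<le> real n * \<theta> + real n * (real n + 1) / 2 * (LINT x|D. max 0 (x - \<theta>))" (is ?le)
proof -
  interpret D: prob_space D by fact
  have intX: "integrable M (X i)" if "i \<in> {1..n}" for i
    using int unfolding D[OF that, symmetric]
    by (subst (asm) integrable_distr_eq) (auto intro: X[OF that])
  have intY: "integrable M (\<lambda>\<omega>. max 0 (X i \<omega> - \<theta>))" if "i \<in> {1..n}" for i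
    using intX[OF that] by (intro integrable_max) auto
  have expY: "expectation (\<lambda>\<omega>. max 0 (X i \<omega> - \<theta>)) = (LINT x|D. max 0 (x - \<theta>))"
    if "i \<in> {1..n}" for i
    unfolding D[OF that, symmetric] by (subst integral_distr) (auto intro: X[OF that])
  let ?U = "\<lambda>\<omega>. real n * \<theta> + (\<Sum>i=1..n. real (n - i + 1) * max 0 (X i \<omega> - \<theta>))"
  have intU: "integrable M ?U"
    by (intro Bochner_Integration.integrable_add Bochner_Integration.integrable_sum
          integrable_mult_right intY) auto
  \<comment> \<open>Selecting every value for one step bounds the optimum from below by the sum of
    the \<open>X i\<close>. Together with the upper bound \<open>?U\<close> this dominates its
    absolute value and gives integrability.\<close>
  have ones: "feasible n (\<lambda>_. 1)"
    by (auto simp: feasible_def covered_def)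
  show ?int
  proof (rule Bochner_Integration.integrable_bound)
    show "integrable M (\<lambda>\<omega>. \<bar>?U \<omega>\<bar> + \<bar>\<Sum>i=1..n. X i \<omega>\<bar>)"
      by (intro Bochner_Integration.integrable_add integrable_abs intU
            Bochner_Integration.integrable_sum intX)
    show "(\<lambda>\<omega>. opt_value n (\<lambda>i. X i \<omega>)) \<in> borel_measurable M"
      using X by (rule borel_measurable_opt_value)
    have "norm (opt_value n (\<lambda>i. X i \<omega>)) \<le> norm (\<bar>?U \<omega>\<bar> + \<bar>\<Sum>i=1..n. X i \<omega>\<bar>)" for \<omega>
      using opt_value_le[OF \<theta>, of n "\<lambda>i. X i \<omega>"]
        total_value_le_opt_value[OF ones, of "\<lambda>i. X i \<omega>"]
      by (simp add: total_value_def del: of_nat_add of_nat_diff)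
    then show "AE \<omega> in M. norm (opt_value n (\<lambda>i. X i \<omega>)) \<le> norm (\<bar>?U \<omega>\<bar> + \<bar>\<Sum>i=1..n. X i \<omega>\<bar>)"
      by simp
  qed
  then have "expectation (\<lambda>\<omega>. opt_value n (\<lambda>i. X i \<omega>)) \<le> expectation ?U"
    using intU by (rule integral_mono) (rule opt_value_le[OF \<theta>])
  also have "\<dots> = real n * \<theta> + (\<Sum>i=1..n. real (n - i + 1) * (LINT x|D. max 0 (x - \<theta>)))"
    by (subst Bochner_Integration.integral_add)
       (auto simp: Bochner_Integration.integral_sum intY expY prob_space simp del: of_nat_add of_nat_diff
          intro!: Bochner_Integration.integrable_sum integrable_mult_right)
  also have "\<dots> = real n * \<theta> + real (\<Sum>i=1..n. n - i + 1) * (LINT x|D. max 0 (x - \<theta>))"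
    by (simp add: sum_distrib_right del: of_nat_add of_nat_diff)
  also have "(\<Sum>i=1..n. n - i + 1) = (\<Sum>i=1..n. i)"
    by (rule sum.reindex_bij_witness[where i="\<lambda>i. n - i + 1" and j="\<lambda>i. n - i + 1"]) auto
  also have "real (\<Sum>i=1..n. i) = real n * (real n + 1) / 2"
    by (induction n) (auto simp: field_simps)
  finally show ?le .
qed

subsection \<open>Value distributions\<close>

text \<open>The condition \<open>cdf D 0 = 0\<close> makes \<open>{..0}\<close> a null set, so
  values are almost surely strictly positive. Strictness later makes the mean positive.\<close>

lemma value_distributionD:
  assumes "value_distribution D f"
  shows "prob_space D" "sets D = sets borel" "integrable D (\<lambda>x. x)" "AE x in D. 0 < x"
proof -
  show "prob_space D" and sets: "sets D = sets borel" and "integrable D (\<lambda>x. x)"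
    using assms by (auto simp: value_distribution_def)
  interpret prob_space D by fact
  have "{..0} \<in> sets D" using sets by simp
  moreover have "emeasure D {..0} = 0"
    unfolding emeasure_eq_measure using assms by (metis cdf_def ennreal_0 value_distribution_def)
  ultimately have "{..0} \<in> null_sets D" by auto
  then show "AE x in D. 0 < x" by (rule AE_I') (auto simp: not_less)
qed

text \<open>For \<open>x > 0\<close> the integrands agree pointwise: a value above
  \<open>\<delta>\<close> splits into \<open>max 0 \<delta>\<close> and its excess, and any other
  value contributes nothing to either side. The truncation at 0 handles negative
  \<open>\<delta>\<close>, which can occur as a quantile of level 0, that is for
  \<open>n = 2\<close>.\<close>

lemma value_distribution_upper_mean:
  assumes "value_distribution D f"
  shows "(LINT x|D. indicator {\<delta><..} x * x)
    = (1 - cdf D \<delta>) * max 0 \<delta> + (LINT x|D. max 0 (x - max 0 \<delta>))"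
proof -
  note vd = value_distributionD[OF assms]
  interpret prob_space D by (rule vd)
  note [measurable_cong] = vd(2)
  have ind: "integrable D (indicator {\<delta><..} :: real \<Rightarrow> real)"
    by (rule integrable_const_bound[where B=1]) (auto simp: indicator_def)
  have "(LINT x|D. indicator {\<delta><..} x * x)
      = (LINT x|D. indicator {\<delta><..} x * max 0 \<delta> + max 0 (x - max 0 \<delta>))"
  proof (rule integral_cong_AE)
    show "AE x in D. indicator {\<delta><..} x * x
        = indicator {\<delta><..} x * max 0 \<delta> + max 0 (x - max 0 \<delta>)"
      using vd(4) by eventually_elim (auto simp: indicator_def)
  qed simp_all
  also have "\<dots> = (LINT x|D. indicator {\<delta><..} x) * max 0 \<delta> + (LINT x|D. max 0 (x - max 0 \<delta>))"
    using ind vd(3)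
    by (subst Bochner_Integration.integral_add) (auto intro!: integrable_max)
  also have "(LINT x|D. indicator {\<delta><..} x) = 1 - cdf D \<delta>"
  proof -
    have "space D = UNIV" using vd(2) sets_eq_imp_space_eq by fastforce
    moreover from this have "{\<delta><..} = space D - {..\<delta>}" by auto
    then have "measure D {\<delta><..} = 1 - cdf D \<delta>"
      using prob_compl[of "{..\<delta>}"] vd(2) by (simp add: cdf_def)
    ultimately show ?thesis by simp
  qed
  finally show ?thesis .
qed

section \<open>Comparing the expectations of Simple and Opt\<close>

theorem theorem2:
  fixes n :: nat and D :: "real measure" and f :: "real \<Rightarrow> real"
    and M :: "'a measure" and X :: "nat \<Rightarrow> 'a \<Rightarrow> real" and \<delta> :: real
  assumes "n > 0"
    and "value_distribution D f"
    and "prob_space M"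
    and "prob_space.indep_vars M (\<lambda>_. borel) X {1..n}"
    and "\<And>i. i \<in> {1..n} \<Longrightarrow> distr M borel (X i) = D"
    and "is_quantile D (1 - 2 / real n) \<delta>"
  shows "prob_space.expectation M (\<lambda>\<omega>. simple_value n \<delta> (\<lambda>i. X i \<omega>))
           / prob_space.expectation M (\<lambda>\<omega>. opt_value n (\<lambda>i. X i \<omega>))
         \<ge> (1 + exp (- 2)) / (3 - exp (- 2))
       \<and> (1 + exp (- 2)) / (3 - exp (- 2)) > (0.396 :: real)"
proof -
  interpret prob_space M by fact
  note vd = value_distributionD[OF \<open>value_distribution D f\<close>]
  interpret D: prob_space D by (rule vd)
  note [measurable_cong] = vd(2)
  have X: "X i \<in> borel_measurable M" if "i \<in> {1..n}" for i
    using assms(4) that unfolding indep_vars_def by blast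
  define \<theta> where "\<theta> = max 0 \<delta>"
  define q where "q = cdf D \<delta>"
  define a where "a = (LINT x|D. max 0 (x - \<theta>))"
  define hi where "hi = (LINT x|D. indicator {\<delta><..} x * x)"
  define lo where "lo = (LINT x|D. indicator {..\<delta>} x * x)"
  define S where "S = (\<Sum>i<n. q ^ i * real (n - i))"
  define T where "T = (\<Sum>i<n. q ^ i)"
  let ?Simple = "expectation (\<lambda>\<omega>. simple_value n \<delta> (\<lambda>i. X i \<omega>))"
  let ?Opt = "expectation (\<lambda>\<omega>. opt_value n (\<lambda>i. X i \<omega>))"
  have simple: "integrable M (\<lambda>\<omega>. simple_value n \<delta> (\<lambda>i. X i \<omega>))"
    "?Simple = S * hi + T * lo"
    using simple_value_expectation[OF assms(4,5) vd(1-3), of \<delta>]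
    by (auto simp only: S_def T_def hi_def lo_def q_def)
  have opt: "integrable M (\<lambda>\<omega>. opt_value n (\<lambda>i. X i \<omega>))"
    "?Opt \<le> real n * \<theta> + real n * (real n + 1) / 2 * a"
    using opt_value_expectation[OF X assms(5) vd(1,3), where \<theta>=\<theta>] by (auto simp: \<theta>_def a_def)
  have "\<theta> \<ge> 0" by (simp add: \<theta>_def)
  have "a \<ge> 0" unfolding a_def by (rule integral_nonneg_AE) simp
  have hi: "hi = (1 - q) * \<theta> + a"
    unfolding hi_def q_def \<theta>_def a_def by (rule value_distribution_upper_mean) fact
  have "hi \<ge> 0" "lo \<ge> 0"
    unfolding hi_def lo_def using vd(4) by (auto intro!: integral_nonneg_AE)
  have "q \<ge> 0" unfolding q_def cdf_def by simp
  \<comment> \<open>The summands with index 0 are \<open>n\<close> and 1, and all others are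
    nonnegative.\<close>
  have S1: "S \<ge> 1" and T1: "T \<ge> 1"
  proof -
    obtain m where m: "n = Suc m" using \<open>n > 0\<close> gr0_implies_Suc by blast
    show "S \<ge> 1" "T \<ge> 1"
      unfolding S_def T_def m sum.lessThan_Suc_shift using \<open>q \<ge> 0\<close>
      by (auto intro!: add_increasing2 sum_nonneg)
  qed
  \<comment> \<open>The right-hand sides are half the coefficients of \<open>a\<close> and
    \<open>\<theta>\<close> in the bound for \<open>?Opt\<close>; the left-hand sides are the
    coefficients of \<open>a\<close> and \<open>\<theta>\<close> in \<open>S * hi\<close>.\<close>
  have Sbounds: "S \<ge> real n * (real n + 1) / 4 \<and> S * (1 - q) \<ge> real n / 2"
  proof (cases "n = 1")
    case True
    \<comment> \<open>For \<open>n = 1\<close> the level is -1, so the convention for negative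
      levels fixes the threshold at 0. Then \<open>q\<close> is 0 rather than
      \<open>1 - 2 / n\<close>, and \<open>S \<ge> 1\<close> is enough.\<close>
    then have "\<delta> = 0" using assms(6) by (simp add: is_quantile_def)
    then have "q = 0" using assms(2) unfolding q_def value_distribution_def by blast
    then show ?thesis using True S1 by simp
  next
    case False
    then have "n \<ge> 2" using \<open>n > 0\<close> by simp
    then have q: "q = 1 - 2 / real n"
      using assms(6) by (auto simp: q_def is_quantile_def field_simps split: if_splits)
    have "S \<ge> real n * (real n + 2) / 4"
      using threshold_weight_ge[OF \<open>n \<ge> 2\<close>] by (simp add: S_def q)
    moreover from this have "S * (1 - q) \<ge> real n * (real n + 2) / 4 * (1 - q)"
      unfolding q by (intro mult_right_mono) auto
    moreover have "real n * (real n + 2) / 4 * (1 - q) = real n / 2 + 1"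
      using \<open>n > 0\<close> by (simp add: q field_simps)
    moreover have "real n * (real n + 1) / 4 \<le> real n * (real n + 2) / 4"
      by (simp add: field_simps)
    ultimately show ?thesis by linarith
  qed
  have half: "?Opt / 2 \<le> ?Simple"
  proof -
    have "real n / 2 * \<theta> + real n * (real n + 1) / 4 * a \<le> S * (1 - q) * \<theta> + S * a"
      using Sbounds \<open>\<theta> \<ge> 0\<close> \<open>a \<ge> 0\<close> by (intro add_mono mult_right_mono) auto
    also have "\<dots> = S * hi" by (simp add: hi algebra_simps)
    \<comment> \<open>The single-step gains at or below the threshold are nonnegative and are
      discarded here.\<close>
    also have "\<dots> \<le> ?Simple" using T1 \<open>lo \<ge> 0\<close> by (simp add: simple(2))
    finally show ?thesis using opt(2) by (simp add: field_simps)
  qed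
  \<comment> \<open>Division by zero yields 0, so the ratio bound requires \<open>?Opt > 0\<close>.
    It follows from \<open>?Simple > 0\<close>, since Simple makes a feasible choice; and
    \<open>?Simple\<close> is at least the mean \<open>hi + lo\<close> of \<open>D\<close>, because
    both weights are at least 1.\<close>
  have "?Simple > 0"
  proof -
    have "hi + lo = (LINT x|D. x)"
    proof -
      have "integrable D (\<lambda>x. indicator {\<delta><..} x * x)" "integrable D (\<lambda>x. indicator {..\<delta>} x * x)"
        using integrable_real_mult_indicator[OF _ vd(3)]
        by (simp_all add: mult.commute[of "indicator _ _"])
      then have "hi + lo = (LINT x|D. indicator {\<delta><..} x * x + indicator {..\<delta>} x * x)"
        by (simp add: hi_def lo_def)
      also have "\<dots> = (LINT x|D. x)"
        by (rule Bochner_Integration.integral_cong) (auto simp: indicator_def)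
      finally show ?thesis .
    qed
    also have "\<dots> > 0"
    proof (rule D.integral_less_AE_space[of "\<lambda>_. 0", simplified])
    qed (use vd D.emeasure_space_1 in auto)
    finally have "hi + lo > 0" .
    moreover have "S * hi \<ge> 1 * hi" "T * lo \<ge> 1 * lo"
      using S1 T1 \<open>hi \<ge> 0\<close> \<open>lo \<ge> 0\<close> by (intro mult_right_mono; simp)+
    ultimately show ?thesis by (simp add: simple(2))
  qed
  moreover have "?Simple \<le> ?Opt"
    using simple(1) opt(1)
    by (rule integral_mono)
      (auto simp: simple_value_def intro: total_value_le_opt_value simple_choice_feasible)
  ultimately have "?Opt > 0" by simp
  with half have "?Simple / ?Opt \<ge> 1 / 2"
    by (simp add: field_simps)
  moreover have "(1 + exp (- 2)) / (3 - exp (- 2)) \<le> (1 / 2 :: real)"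
    and "(1 + exp (- 2)) / (3 - exp (- 2)) > (0.396 :: real)"
  proof -
    have "exp 2 = (exp (1::real))\<^sup>2" using exp_double[of "1::real"] by simp
    moreover have "(exp 1)\<^sup>2 < (272 / 100 :: real)\<^sup>2"
      using e_less_272 by (intro power_strict_mono) auto
    ultimately have "exp 2 < (7.4 :: real)" by (simp add: power2_eq_square)
    \<comment> \<open>With \<open>y = exp (- 2)\<close>, the ratio \<open>(1 + y) / (3 - y)\<close>
      is at most 1/2 exactly when \<open>y \<le> 1 / 3\<close>. It exceeds 0.396 once
      \<open>y > 0.188 / 1.396\<close>, which is below 0.135; the upper bound 7.4 on
      \<open>exp 2\<close> secures this.\<close>
    moreover have "exp 2 \<ge> (3 :: real)" using exp_ge_add_one_self[of 2] by simp
    ultimately have "exp (- 2) \<le> (1 / 3 :: real)" "exp (- 2) > (0.135 :: real)"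
      by (simp_all add: exp_minus inverse_eq_divide field_simps)
    then show "(1 + exp (- 2)) / (3 - exp (- 2)) \<le> (1 / 2 :: real)"
      and "(1 + exp (- 2)) / (3 - exp (- 2)) > (0.396 :: real)"
      by (simp_all add: field_simps)
  qed
  ultimately show ?thesis by linarith
qed

end
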